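(* Let $M\in\mathbb{N}$, $M\ge 1$, be fixed, and let $\Phi_h^{[M]}:(q,p)\mapsto(\tilde q,\tilde p)$ be the numerical flow of the $p$-implicit Symplectic Euler method with $M$ fixed point iterations for the Hamiltonian $H$. Then the diagonal blocks of $\tilde J=(D\Phi_h^{[M]})^TJ(D\Phi_h^{[M]})$, which are $[\tilde q_q,\tilde p_q]$ (upper left) and $[\tilde q_p,\tilde p_p]$ (lower right), satisfy $$[\tilde q_p,\tilde p_p]=O \ \text{ (the zero matrix)}$$ and $$[\tilde q_q,\tilde p_q]=\mathcal{O}(h^{M+1}),\qquad h\to 0 .$$
   Context: For square real matrices $R,S'$ of the same size, $[R,S']:=R^TS'-S'^TR$. Let $N\ge 1$, let $\mathcal{D}\subset\mathbb{R}^N\times\mathbb{R}^N$ be compact and convex, and let $H=H(q,p)$ be a real-valued Hamiltonian which is sufficiently smooth on $\mathcal{D}$ (all derivatives exist and are continuous; concretely, $H$ is $C^\infty$ on an open neighbourhood of $\mathcal{D}$). $H_q,H_p$ denote the gradients of $H$ with respect to $q$ and $p$. $J=\begin{pmatrix}O&I\\-I&O\end{pmatrix}\in\mathbb{R}^{2N\times 2N}$, with $I$ the $N\times N$ identity. The $p$-implicit Symplectic Euler method with $M$ fixed point iterations and step $h>0$: given $(q,p)$, put $p_0:=p$, $p_{n+1}:=p-hH_q(q,p_n)$ for $n=0,\dots,M-1$, $\tilde p:=p_M$, $\tilde q:=q+hH_p(q,\tilde p)$; the numerical flow is $\Phi_h^{[M]}(q,p):=(\tilde q,\tilde p)$. The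 $N\times N$ matrices $\tilde q_q,\tilde q_p,\tilde p_q,\tilde p_p$ are the Jacobian blocks, e.g. $\tilde p_q=(\partial\tilde p_r/\partial q_s)_{r,s}$, and $D\Phi_h^{[M]}=\begin{pmatrix}\tilde q_q&\tilde q_p\\ \tilde p_q&\tilde p_p\end{pmatrix}$. Standing assumption: $S\subset\mathcal{D}$ is a set of initial values and $h_0>0$ is such that for all $0<h\le h_0$ and $(q,p)\in S$ all points at which $H$ and its derivatives are evaluated in the scheme, and the result of the step, lie in $\mathcal{D}$. A matrix depending on $h$ and $(q,p)$ is $\mathcal{O}(h^r)$ if its norm is at most $Ch^r$ for all sufficiently small $h\in(0,h_0]$ and all $(q,p)\in S$, with $C$ independent of $h$ and $(q,p)$ (it may depend on $H,\mathcal{D},M,N$). *)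

theory Defs
  imports "HOL-Analysis.Analysis"
begin

text \<open>
  Phase space \<open>\<real>\<^sup>N \<times> \<real>\<^sup>N\<close> is \<open>(real^'n) \<times> (real^'n)\<close> with \<open>N = CARD('n)\<close>; a point is \<open>(q, p)\<close>.
\<close>

type_synonym 'n phase = "(real^'n) \<times> (real^'n)"

text \<open>
  The definitions of \<open>Ck_on\<close> and \<open>smooth_on\<close> are meant for open \<open>U\<close>: the derivatives are taken at
  full neighbourhoods. \<open>Ck_on k U f\<close> says that all iterated partial derivatives up to order \<open>k\<close>
  exist (in the Frechet sense) and are continuous.
\<close>

primrec Ck_on :: "nat \<Rightarrow> 'a::euclidean_space set \<Rightarrow> ('a \<Rightarrow> real) \<Rightarrow> bool" where
  "Ck_on 0 U f \<longleftrightarrow> continuous_on U f"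
| "Ck_on (Suc k) U f \<longleftrightarrow> continuous_on U f \<and> (\<forall>x\<in>U. f differentiable (at x)) \<and>
     (\<forall>b\<in>Basis. Ck_on k U (\<lambda>x. frechet_derivative f (at x) b))"

definition smooth_on :: "'a::euclidean_space set \<Rightarrow> ('a \<Rightarrow> real) \<Rightarrow> bool" where
  "smooth_on U f \<longleftrightarrow> (\<forall>k. Ck_on k U f)"

definition grad :: "('a::euclidean_space \<Rightarrow> real) \<Rightarrow> 'a \<Rightarrow> 'a" where
  "grad f x = (THE D. GDERIV f x :> D)"

definition grad_q :: "('n::finite phase \<Rightarrow> real) \<Rightarrow> real^'n \<Rightarrow> real^'n \<Rightarrow> real^'n" where
  "grad_q H q p = grad (\<lambda>x. H (x, p)) q"

definition grad_p :: "('n::finite phase \<Rightarrow> real) \<Rightarrow> real^'n \<Rightarrow> real^'n \<Rightarrow> real^'n" where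
  "grad_p H q p = grad (\<lambda>y. H (q, y)) p"

primrec p_iter :: "('n::finite phase \<Rightarrow> real) \<Rightarrow> real \<Rightarrow> real^'n \<Rightarrow> real^'n \<Rightarrow> nat \<Rightarrow> real^'n" where
  "p_iter H h q p 0 = p"
| "p_iter H h q p (Suc n) = p - h *\<^sub>R grad_q H q (p_iter H h q p n)"

definition euler_flow :: "('n::finite phase \<Rightarrow> real) \<Rightarrow> nat \<Rightarrow> real \<Rightarrow> 'n phase \<Rightarrow> 'n phase" where
  "euler_flow H M h = (\<lambda>(q, p). let p' = p_iter H h q p M in (q + h *\<^sub>R grad_p H q p', p'))"

text \<open>
  The scheme evaluates \<open>H\<^sub>q\<close> at \<open>(q, p\<^sub>n)\<close> for \<open>n < M\<close> and \<open>H\<^sub>p\<close> at \<open>(q, p\<^sub>M)\<close>, hence the range \<open>n \<le> M\<close>.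
\<close>

definition admissible ::
  "('n::finite phase \<Rightarrow> real) \<Rightarrow> 'n phase set \<Rightarrow> nat \<Rightarrow> 'n phase set \<Rightarrow> real \<Rightarrow> bool" where
  "admissible H D M S h0 \<longleftrightarrow> S \<subseteq> D \<and> 0 < h0 \<and>
     (\<forall>h q p. 0 < h \<and> h \<le> h0 \<and> (q, p) \<in> S \<longrightarrow>
        (\<forall>n\<le>M. (q, p_iter H h q p n) \<in> D) \<and> euler_flow H M h (q, p) \<in> D)"

definition jac_q :: "('n::finite phase \<Rightarrow> real^'n) \<Rightarrow> 'n phase \<Rightarrow> real^'n^'n" where
  "jac_q f z = jacobian (\<lambda>x. f (x, snd z)) (at (fst z))"

definition jac_p :: "('n::finite phase \<Rightarrow> real^'n) \<Rightarrow> 'n phase \<Rightarrow> real^'n^'n" where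
  "jac_p f z = jacobian (\<lambda>y. f (fst z, y)) (at (snd z))"

text \<open>\<open>Inl\<close> indexes the \<open>q\<close>-coordinates and \<open>Inr\<close> the \<open>p\<close>-coordinates of \<open>\<real>\<^sup>2\<^sup>N\<close>.\<close>

definition block_matrix ::
  "real^'n^'n \<Rightarrow> real^'n^'n \<Rightarrow> real^'n^'n \<Rightarrow> real^'n^'n \<Rightarrow> real^('n::finite + 'n)^('n + 'n)" where
  "block_matrix A B C E = (\<chi> i j. case i of
       Inl r \<Rightarrow> (case j of Inl s \<Rightarrow> A $ r $ s | Inr s \<Rightarrow> B $ r $ s)
     | Inr r \<Rightarrow> (case j of Inl s \<Rightarrow> C $ r $ s | Inr s \<Rightarrow> E $ r $ s))"

definition upper_left :: "real^('n::finite + 'n)^('n + 'n) \<Rightarrow> real^'n^'n" where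
  "upper_left A = (\<chi> r s. A $ Inl r $ Inl s)"

definition lower_right :: "real^('n::finite + 'n)^('n + 'n) \<Rightarrow> real^'n^'n" where
  "lower_right A = (\<chi> r s. A $ Inr r $ Inr s)"

definition J_matrix :: "real^('n::finite + 'n)^('n + 'n)" where
  "J_matrix = block_matrix 0 (mat 1) (- mat 1) 0"

definition phase_jacobian ::
  "('n::finite phase \<Rightarrow> 'n phase) \<Rightarrow> 'n phase \<Rightarrow> real^('n + 'n)^('n + 'n)" where
  "phase_jacobian F z = block_matrix
     (jac_q (\<lambda>w. fst (F w)) z) (jac_p (\<lambda>w. fst (F w)) z)
     (jac_q (\<lambda>w. snd (F w)) z) (jac_p (\<lambda>w. snd (F w)) z)"

definition J_tilde ::
  "('n::finite phase \<Rightarrow> 'n phase) \<Rightarrow> 'n phase \<Rightarrow> real^('n + 'n)^('n + 'n)" where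
  "J_tilde F z = transpose (phase_jacobian F z) ** J_matrix ** phase_jacobian F z"

definition mat_bracket :: "real^'n^'n \<Rightarrow> real^'n^'n \<Rightarrow> real^'n^'n::finite" where
  "mat_bracket R S = transpose R ** S - transpose S ** R"

end

theory Submission
  imports Defs
begin

text \<open>
  Write \<open>p\<^sub>n\<close> for the fixed point iterates, \<open>A\<^sub>n\<close>, \<open>B\<^sub>n\<close>, \<open>E\<^sub>n\<close> for the second derivatives
  \<open>H\<^sub>q\<^sub>q\<close>, \<open>H\<^sub>q\<^sub>p\<close>, \<open>H\<^sub>p\<^sub>p\<close> at \<open>(q, p\<^sub>n)\<close>, and \<open>Q\<^sub>n\<close>, \<open>P\<^sub>n\<close> for the Jacobians of \<open>p\<^sub>n\<close> with respect to
  \<open>q\<close> and \<open>p\<close>. Differentiating the iteration gives \<open>Q\<^sub>n\<^sub>+\<^sub>1 = - h (A\<^sub>n + B\<^sub>n Q\<^sub>n)\<close>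
  (\<open>has_derivative_p_iter\<close>), and differentiating \<open>q + h H\<^sub>p(q, p\<^sub>M)\<close> gives the blocks
  \<open>I + h (B\<^sub>M\<^sup>T + E\<^sub>M Q\<^sub>M)\<close> and \<open>h E\<^sub>M P\<^sub>M\<close> (\<open>has_derivative_flow_q\<close>).

  The lower right block of \<open>J_tilde\<close> is then \<open>h (P\<^sub>M\<^sup>T E\<^sub>M\<^sup>T P\<^sub>M - P\<^sub>M\<^sup>T E\<^sub>M P\<^sub>M)\<close>, which vanishes because the
  Hessian is symmetric (\<open>symmetric_second_derivative\<close>).

  In the upper left block the terms \<open>h Q\<^sub>M\<^sup>T E\<^sub>M Q\<^sub>M\<close> cancel, leaving \<open>X - X\<^sup>T\<close> with
  \<open>X = Q\<^sub>M + h B\<^sub>M Q\<^sub>M\<close>. Adding the symmetric matrix \<open>h A\<^sub>M\<close> to \<open>X\<close> does not change this difference, and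
  \<open>Q\<^sub>M + h (A\<^sub>M + B\<^sub>M Q\<^sub>M) = Q\<^sub>M - Q\<^sub>M\<^sub>+\<^sub>1\<close>. So the block measures by how much \<open>Q\<^sub>M\<close> fails to be a
  fixed point of the differentiated iteration (\<open>mat_bracket_fixed_point_defect\<close>). Each step of the
  fixed point iteration gains a power of \<open>h\<close>: \<open>p\<^sub>n\<^sub>+\<^sub>1 - p\<^sub>n = O(h\<^sup>n\<^sup>+\<^sup>1)\<close>, because \<open>H\<^sub>q\<close> is bounded and
  Lipschitz on the compact convex set \<open>D\<close>, and from this \<open>Q\<^sub>n\<^sub>+\<^sub>1 - Q\<^sub>n = O(h\<^sup>n\<^sup>+\<^sup>1)\<close>, because \<open>A\<close> and \<open>B\<close>
  are Lipschitz as well (\<open>iter_jac_q_step_bound\<close>). All constants depend on \<open>H\<close>, \<open>D\<close> and \<open>M\<close> only,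
  and the bound holds already for \<open>h \<le> 1\<close>.
\<close>

section \<open>Symmetry of second derivatives\<close>

text \<open>
  The mean value theorem is applied twice: in direction \<open>b\<close> to the increment of \<open>f\<close> along \<open>t c\<close>,
  then in direction \<open>c\<close> to the resulting derivative \<open>f' \<cdot> b\<close>.
\<close>

lemma second_difference_mean_value:
  fixes f :: "'a::real_normed_vector \<Rightarrow> real"
  assumes f: "\<And>x. x \<in> ball z e \<Longrightarrow> (f has_derivative f' x) (at x)"
    and g: "\<And>x. x \<in> ball z e \<Longrightarrow> ((\<lambda>y. f' y b) has_derivative g' x) (at x)"
    and t: "0 < t" "t * (norm b + norm c) < e"
  shows "\<exists>x. dist x z \<le> t * (norm b + norm c) \<and>
    f (z + t *\<^sub>R b + t *\<^sub>R c) - f (z + t *\<^sub>R b) - f (z + t *\<^sub>R c) + f z = t\<^sup>2 * g' x c"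
proof -
  have near: "dist (z + s *\<^sub>R b + r *\<^sub>R c) z \<le> t * (norm b + norm c)"
    if "0 \<le> s" "s \<le> t" "0 \<le> r" "r \<le> t" for s r
  proof -
    have "norm (s *\<^sub>R b + r *\<^sub>R c) \<le> s * norm b + r * norm c"
      using norm_triangle_ineq[of "s *\<^sub>R b" "r *\<^sub>R c"] that by simp
    also have "\<dots> \<le> t * norm b + t * norm c"
      using that by (intro add_mono mult_right_mono) auto
    finally show ?thesis
      by (simp add: dist_norm algebra_simps)
  qed
  have inball: "z + s *\<^sub>R b + r *\<^sub>R c \<in> ball z e"
    if "0 \<le> s" "s \<le> t" "0 \<le> r" "r \<le> t" for s r
    using near[OF that] t by (simp add: dist_commute)
  have line: "((\<lambda>s. F (a + s *\<^sub>R v)) has_real_derivative F' v) (at s)"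
    if "(F has_derivative F') (at (a + s *\<^sub>R v))"
    for F :: "'a \<Rightarrow> real" and F' a v s
  proof -
    have "((\<lambda>s. F (a + s *\<^sub>R v)) has_derivative (\<lambda>s. F' (s *\<^sub>R v))) (at s)"
      by (rule has_derivative_compose[where f = "\<lambda>s. a + s *\<^sub>R v" and g = F])
        (auto intro!: derivative_eq_intros that)
    moreover have "F' (x *\<^sub>R v) = F' v * x" for x
      using has_derivative_linear[OF that] by (simp add: linear_cmul)
    ultimately show ?thesis
      by (simp add: has_field_derivative_def)
  qed
  \<comment> \<open>The second difference is \<open>\<phi> t - \<phi> 0\<close>.\<close>
  define \<phi> where "\<phi> s = f (z + t *\<^sub>R c + s *\<^sub>R b) - f (z + s *\<^sub>R b)" for s
  have "(\<phi> has_real_derivative f' (z + t *\<^sub>R c + s *\<^sub>R b) b - f' (z + s *\<^sub>R b) b) (at s)"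
    if "0 \<le> s" "s \<le> t" for s
    unfolding \<phi>_def
    using inball[OF that, of t] inball[OF that, of 0] t
    by (intro DERIV_diff line f) (auto simp: add_ac)
  from MVT2[OF t(1) this] obtain s where s: "0 < s" "s < t"
    and \<phi>s: "\<phi> t - \<phi> 0 = t * (f' (z + t *\<^sub>R c + s *\<^sub>R b) b - f' (z + s *\<^sub>R b) b)"
    by auto
  have "((\<lambda>r. f' (z + s *\<^sub>R b + r *\<^sub>R c) b) has_real_derivative g' (z + s *\<^sub>R b + r *\<^sub>R c) c) (at r)"
    if "0 \<le> r" "r \<le> t" for r
    by (rule line) (use g inball that s in auto)
  from MVT2[OF t(1) this] obtain r where r: "0 < r" "r < t"
    and "f' (z + s *\<^sub>R b + t *\<^sub>R c) b - f' (z + s *\<^sub>R b) b = t * g' (z + s *\<^sub>R b + r *\<^sub>R c) c"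
    by auto
  with \<phi>s have "\<phi> t - \<phi> 0 = t\<^sup>2 * g' (z + s *\<^sub>R b + r *\<^sub>R c) c"
    by (simp add: add_ac power2_eq_square)
  then show ?thesis
    using near[of s r] s r
    by (intro exI[of _ "z + s *\<^sub>R b + r *\<^sub>R c"]) (simp add: \<phi>_def algebra_simps)
qed

text \<open>
  The second difference of \<open>f\<close> over the parallelogram spanned by \<open>t b\<close> and \<open>t c\<close> is symmetric in \<open>b\<close>
  and \<open>c\<close>. Divided by \<open>t\<^sup>2\<close> it is a value of either mixed derivative at some point near \<open>z\<close>, so
  continuity makes the two agree at \<open>z\<close>.
\<close>

theorem symmetric_second_derivative:
  fixes f :: "'a::real_normed_vector \<Rightarrow> real"
  assumes U: "open U" "z \<in> U"
    and f: "\<And>x. x \<in> U \<Longrightarrow> (f has_derivative f' x) (at x)"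
    and gb: "\<And>x. x \<in> U \<Longrightarrow> ((\<lambda>y. f' y b) has_derivative gb x) (at x)"
    and gc: "\<And>x. x \<in> U \<Longrightarrow> ((\<lambda>y. f' y c) has_derivative gc x) (at x)"
    and cont: "isCont (\<lambda>x. gb x c) z" "isCont (\<lambda>x. gc x b) z"
  shows "gb z c = gc z b"
proof (rule ccontr)
  define \<epsilon> where "\<epsilon> = \<bar>gb z c - gc z b\<bar> / 2"
  assume "gb z c \<noteq> gc z b"
  then have "\<epsilon> > 0" by (simp add: \<epsilon>_def)
  obtain d1 where d1: "d1 > 0" "\<And>x. dist x z < d1 \<Longrightarrow> dist (gb x c) (gb z c) < \<epsilon>"
    using cont(1) \<open>\<epsilon> > 0\<close> unfolding continuous_at_eps_delta by blast
  obtain d2 where d2: "d2 > 0" "\<And>x. dist x z < d2 \<Longrightarrow> dist (gc x b) (gc z b) < \<epsilon>"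
    using cont(2) \<open>\<epsilon> > 0\<close> unfolding continuous_at_eps_delta by blast
  obtain e0 where e0: "e0 > 0" "ball z e0 \<subseteq> U"
    using U open_contains_ball by blast
  define e where "e = min e0 (min d1 d2)"
  have e: "e > 0" "e \<le> e0" "e \<le> d1" "e \<le> d2"
    using d1 d2 e0 by (auto simp: e_def)
  \<comment> \<open>The summand 1 avoids a division by zero and makes the second inequality for \<open>t\<close> strict.\<close>
  define t where "t = e / (norm b + norm c + 1)"
  have nn: "norm b + norm c + 1 > 0"
    using norm_ge_zero[of b] norm_ge_zero[of c] by linarith
  have t: "t > 0" "t * (norm b + norm c) < e"
    using e nn by (auto simp: t_def field_simps)
  have inU: "x \<in> U" if "x \<in> ball z e" for x
    using that e e0 by auto
  let ?\<Delta> = "f (z + t *\<^sub>R b + t *\<^sub>R c) - f (z + t *\<^sub>R b) - f (z + t *\<^sub>R c) + f z"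
  obtain x where x: "dist x z \<le> t * (norm b + norm c)" "?\<Delta> = t\<^sup>2 * gb x c"
    using second_difference_mean_value[OF f gb t] inU by blast
  have t': "t * (norm c + norm b) < e"
    using t by (simp add: add.commute)
  obtain y where y: "dist y z \<le> t * (norm c + norm b)"
    "f (z + t *\<^sub>R c + t *\<^sub>R b) - f (z + t *\<^sub>R c) - f (z + t *\<^sub>R b) + f z = t\<^sup>2 * gc y b"
    using second_difference_mean_value[OF f gc t(1) t'] inU by blast
  have "t\<^sup>2 * gb x c = t\<^sup>2 * gc y b"
    using x(2) y(2) by (simp add: algebra_simps)
  then have "gb x c = gc y b"
    using t by simp
  moreover have "dist (gb x c) (gb z c) < \<epsilon>" "dist (gc y b) (gc z b) < \<epsilon>"
    using d1 d2 x(1) y(1) t t' e by force+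
  ultimately show False
    by (simp add: \<epsilon>_def dist_real_def abs_if split: if_splits)
qed

section \<open>Smooth functions on a compact convex set\<close>

definition partial :: "'a::euclidean_space \<Rightarrow> ('a \<Rightarrow> real) \<Rightarrow> 'a \<Rightarrow> real" where
  "partial b f z = frechet_derivative f (at z) b"

text \<open>
  A derivative in coordinates: smoothness controls only the values of derivatives on basis vectors,
  so all further derivatives are expressed through them.
\<close>

lemma smooth_on_has_derivative:
  assumes "smooth_on U f" "x \<in> U"
  shows "(f has_derivative (\<lambda>v. \<Sum>b\<in>Basis. (v \<bullet> b) * partial b f x)) (at x)"
proof -
  have "f differentiable (at x)"
    using assms Ck_on.simps(2)[of 0 U f] unfolding smooth_on_def by blast
  then have D: "(f has_derivative frechet_derivative f (at x)) (at x)"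
    by (simp add: frechet_derivative_works)
  have "frechet_derivative f (at x) v = (\<Sum>b\<in>Basis. (v \<bullet> b) * partial b f x)" for v
  proof -
    have "frechet_derivative f (at x) v = frechet_derivative f (at x) (\<Sum>b\<in>Basis. (v \<bullet> b) *\<^sub>R b)"
      by (simp add: euclidean_representation)
    also have "\<dots> = (\<Sum>b\<in>Basis. (v \<bullet> b) * partial b f x)"
      using has_derivative_linear[OF D]
      by (simp add: linear_sum linear_cmul partial_def)
    finally show ?thesis .
  qed
  with D show ?thesis
    by (metis (no_types, lifting) ext)
qed

lemma smooth_on_partial:
  assumes "smooth_on U f" "b \<in> Basis"
  shows "smooth_on U (partial b f)"
  using assms unfolding smooth_on_def partial_def[abs_def] by (metis Ck_on.simps(2))

lemma smooth_on_continuous: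
  assumes "smooth_on U f"
  shows "continuous_on U f"
  using assms unfolding smooth_on_def by (metis Ck_on.simps(1))

lemma partial_commute:
  assumes U: "open U" "z \<in> U" and f: "smooth_on U f" and b: "b \<in> Basis" "c \<in> Basis"
  shows "partial c (partial b f) z = partial b (partial c f) z"
proof -
  let ?f' = "\<lambda>x v. \<Sum>b\<in>Basis. (v \<bullet> b) * partial b f x"
  let ?g' = "\<lambda>a x v. \<Sum>b\<in>Basis. (v \<bullet> b) * partial b (partial a f) x"
  have basis: "(\<Sum>e\<in>Basis. (a \<bullet> e) * h e) = h a" if "a \<in> Basis" for a :: 'a and h
    using that by (simp add: inner_Basis if_distrib[of "\<lambda>x. x * _"] cong: if_cong)
  have g: "((\<lambda>y. ?f' y a) has_derivative ?g' a x) (at x)" if "x \<in> U" "a \<in> Basis" for x a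
    using smooth_on_has_derivative[OF smooth_on_partial[OF f that(2)] that(1)] that(2)
    by (simp add: basis)
  have cont: "isCont (\<lambda>x. ?g' a x a') z" if "a \<in> Basis" "a' \<in> Basis" for a a'
    using smooth_on_continuous[OF smooth_on_partial[OF smooth_on_partial[OF f that(1)] that(2)]]
      U that by (simp add: basis continuous_on_eq_continuous_at)
  have "?g' b z c = ?g' c z b"
    by (rule symmetric_second_derivative[OF U smooth_on_has_derivative[OF f] g g cont cont])
      (use b in auto)
  then show ?thesis
    using b by (simp add: basis)
qed

text \<open>
  The partial derivatives are continuous, hence bounded on the compact set; convexity turns the
  bound on the derivative into a Lipschitz constant.
\<close>

lemma smooth_on_lipschitz:
  assumes f: "smooth_on U f" and D: "compact D" "convex D" "D \<subseteq> U"
  shows "\<exists>L. L-lipschitz_on D f"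
proof -
  have "\<exists>K. \<forall>x\<in>D. \<bar>partial b f x\<bar> \<le> K" if "b \<in> Basis" for b
  proof -
    have "continuous_on D (partial b f)"
      using smooth_on_continuous[OF smooth_on_partial[OF f that]] D continuous_on_subset by blast
    then have "bounded (partial b f ` D)"
      using D compact_continuous_image compact_imp_bounded by blast
    then show ?thesis
      by (auto simp: bounded_iff)
  qed
  then obtain K where K: "\<And>b x. b \<in> Basis \<Longrightarrow> x \<in> D \<Longrightarrow> \<bar>partial b f x\<bar> \<le> K b"
    by metis
  have "dist (f x) (f y) \<le> (\<Sum>b\<in>Basis. \<bar>K b\<bar>) * dist x y" if "x \<in> D" "y \<in> D" for x y
    unfolding dist_norm
  proof (rule differentiable_bound[OF D(2) _ _ that])
    fix x assume x: "x \<in> D"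
    show "(f has_derivative (\<lambda>v. \<Sum>b\<in>Basis. (v \<bullet> b) * partial b f x)) (at x within D)"
      using smooth_on_has_derivative[OF f] x D has_derivative_at_withinI by blast
    show "onorm (\<lambda>v. \<Sum>b\<in>Basis. (v \<bullet> b) * partial b f x) \<le> (\<Sum>b\<in>Basis. \<bar>K b\<bar>)"
    proof (rule onorm_le)
      fix v :: 'a
      have "norm (\<Sum>b\<in>Basis. (v \<bullet> b) * partial b f x) \<le> (\<Sum>b\<in>Basis. norm v * \<bar>K b\<bar>)"
      proof (rule sum_norm_le)
        fix b :: 'a assume b: "b \<in> Basis"
        show "norm ((v \<bullet> b) * partial b f x) \<le> norm v * \<bar>K b\<bar>"
          using Basis_le_norm[OF b, of v] K[OF b x]
          by (auto simp: abs_mult intro!: mult_mono)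
      qed
      then show "norm (\<Sum>b\<in>Basis. (v \<bullet> b) * partial b f x) \<le> (\<Sum>b\<in>Basis. \<bar>K b\<bar>) * norm v"
        by (simp add: sum_distrib_left mult.commute)
    qed
  qed
  then show ?thesis
    by (intro exI[of _ "\<Sum>b\<in>Basis. \<bar>K b\<bar>"] lipschitz_onI) (auto intro: sum_nonneg)
qed

lemma lipschitz_on_componentwise:
  fixes f :: "'a::metric_space \<Rightarrow> 'b::euclidean_space"
  assumes "\<And>b. b \<in> Basis \<Longrightarrow> \<exists>L. L-lipschitz_on D (\<lambda>x. f x \<bullet> b)"
  shows "\<exists>L. L-lipschitz_on D f"
proof -
  obtain L where L: "\<And>b. b \<in> Basis \<Longrightarrow> (L b)-lipschitz_on D (\<lambda>x. f x \<bullet> b)"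
    using assms by metis
  have "dist (f x) (f y) \<le> (\<Sum>b\<in>Basis. L b) * dist x y" if "x \<in> D" "y \<in> D" for x y
  proof -
    have "dist (f x) (f y) \<le> (\<Sum>b\<in>Basis. \<bar>(f x - f y) \<bullet> b\<bar>)"
      unfolding dist_norm by (rule norm_le_l1)
    also have "\<dots> \<le> (\<Sum>b\<in>Basis. L b * dist x y)"
      using lipschitz_onD[OF L that] by (intro sum_mono) (simp add: dist_real_def inner_diff_left)
    finally show ?thesis
      by (simp add: sum_distrib_right)
  qed
  then show ?thesis
    using lipschitz_on_nonneg[OF L] by (intro exI lipschitz_onI) (auto intro: sum_nonneg)
qed

section \<open>Block matrices\<close>

lemma sum_UNIV_Plus:
  "(\<Sum>k\<in>UNIV. g k) = (\<Sum>i\<in>UNIV. g (Inl i)) + (\<Sum>i\<in>UNIV. g (Inr i :: 'a::finite + 'b::finite))"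
  by (simp add: sum.Plus flip: UNIV_Plus_UNIV)

lemma block_matrix_mult:
  "block_matrix A B C E ** block_matrix A' B' C' E' =
    block_matrix (A ** A' + B ** C') (A ** B' + B ** E') (C ** A' + E ** C') (C ** B' + E ** E')"
  by (auto simp: vec_eq_iff block_matrix_def matrix_matrix_mult_def sum_UNIV_Plus split: sum.split)

lemma transpose_block_matrix:
  "transpose (block_matrix A B C E) =
    block_matrix (transpose A) (transpose C) (transpose B) (transpose E)"
  by (auto simp: vec_eq_iff block_matrix_def transpose_def split: sum.split)

lemma
  shows upper_left_block_matrix: "upper_left (block_matrix A B C E) = A"
    and lower_right_block_matrix: "lower_right (block_matrix A B C E) = E"
  by (simp_all add: vec_eq_iff block_matrix_def upper_left_def lower_right_def)

lemma matrix_mult_uminus: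
  fixes A :: "real^'n^'m" and B :: "real^'k^'n"
  shows "A ** (- B) = - (A ** B)" "(- A) ** B = - (A ** B)"
  by (simp_all add: vec_eq_iff matrix_matrix_mult_def sum_negf)

lemma
  shows upper_left_J_tilde: "upper_left (J_tilde F z) =
      mat_bracket (jac_q (\<lambda>w. fst (F w)) z) (jac_q (\<lambda>w. snd (F w)) z)"
    and lower_right_J_tilde: "lower_right (J_tilde F z) =
      mat_bracket (jac_p (\<lambda>w. fst (F w)) z) (jac_p (\<lambda>w. snd (F w)) z)"
  by (simp_all add: J_tilde_def J_matrix_def phase_jacobian_def block_matrix_mult
      transpose_block_matrix upper_left_block_matrix lower_right_block_matrix mat_bracket_def
      matrix_mult_uminus)

section \<open>Derivatives of the gradients of the Hamiltonian\<close>

definition unit_q :: "'n::finite \<Rightarrow> 'n phase" where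
  "unit_q r = (axis r 1, 0)"

definition unit_p :: "'n::finite \<Rightarrow> 'n phase" where
  "unit_p r = (0, axis r 1)"

text \<open>
  The argument \<open>u\<close> is \<open>unit_q\<close> or \<open>unit_p\<close> and selects the block; passing the unit vectors as a
  function lets one lemma serve all the blocks of the gradient and of the Hessian. In
  \<open>hess_block u w\<close> the rows follow \<open>u\<close> and the columns \<open>w\<close>, so \<open>hess_block unit_q unit_p\<close> is \<open>H\<^sub>q\<^sub>p\<close>, the
  Jacobian of \<open>H\<^sub>q\<close> in \<open>p\<close>.
\<close>

definition grad_block :: "('n \<Rightarrow> 'n phase) \<Rightarrow> ('n::finite phase \<Rightarrow> real) \<Rightarrow> 'n phase \<Rightarrow> real^'n" where
  "grad_block u H z = (\<chi> r. partial (u r) H z)"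

definition hess_block ::
  "('n \<Rightarrow> 'n phase) \<Rightarrow> ('n \<Rightarrow> 'n phase) \<Rightarrow> ('n::finite phase \<Rightarrow> real) \<Rightarrow> 'n phase \<Rightarrow> real^'n^'n" where
  "hess_block u w H z = (\<chi> r s. partial (w s) (partial (u r) H) z)"

lemma unit_in_Basis [simp]: "unit_q r \<in> Basis" "unit_p r \<in> Basis"
  by (auto simp: unit_q_def unit_p_def Basis_prod_def axis_in_Basis_iff)

lemma sum_Basis_vec:
  fixes g :: "real^'n \<Rightarrow> real"
  shows "(\<Sum>b\<in>Basis. g b) = (\<Sum>r\<in>UNIV. g (axis r 1))"
proof -
  have "(Basis :: (real^'n) set) = range (\<lambda>r. axis r 1)"
    by (auto simp: Basis_vec_def)
  then have "(\<Sum>b\<in>Basis. g b) = (\<Sum>b\<in>range (\<lambda>r. axis r 1). g b)"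
    by (rule arg_cong)
  also have "\<dots> = (\<Sum>r\<in>UNIV. g (axis r 1))"
    by (simp add: sum.reindex inj_on_def axis_eq_axis)
  finally show ?thesis .
qed

lemma sum_Basis_phase:
  fixes g :: "'n::finite phase \<Rightarrow> real"
  shows "(\<Sum>b\<in>Basis. g b) = (\<Sum>r\<in>UNIV. g (unit_q r)) + (\<Sum>r\<in>UNIV. g (unit_p r))"
proof -
  have "(\<Sum>b\<in>Basis. g b) = (\<Sum>b\<in>(\<lambda>u. (u, 0)) ` Basis. g b) + (\<Sum>b\<in>(\<lambda>u. (0, u)) ` Basis. g b)"
    unfolding Basis_prod_def by (rule sum.union_disjoint) auto
  then show ?thesis
    by (simp add: sum.reindex inj_on_def sum_Basis_vec unit_q_def unit_p_def)
qed

lemma inner_unit: "v \<bullet> unit_q r = fst v $ r" "v \<bullet> unit_p r = snd v $ r"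
  by (simp_all add: unit_q_def unit_p_def inner_prod_def inner_axis)

lemma has_derivative_phase:
  assumes "smooth_on U f" "z \<in> U"
  shows "(f has_derivative (\<lambda>v. (\<Sum>r\<in>UNIV. fst v $ r * partial (unit_q r) f z)
    + (\<Sum>r\<in>UNIV. snd v $ r * partial (unit_p r) f z))) (at z)"
  using smooth_on_has_derivative[OF assms] by (simp add: sum_Basis_phase inner_unit)

lemma grad_eqI:
  assumes "GDERIV f x :> D"
  shows "grad f x = D"
proof -
  have "D' = D" if "GDERIV f x :> D'" for D'
  proof -
    have "(\<lambda>h. h \<bullet> D') = (\<lambda>h. h \<bullet> D)"
      using has_derivative_unique[OF that[unfolded gderiv_def] assms[unfolded gderiv_def]] .
    then show ?thesis
      unfolding fun_eq_iff vector_eq_ldot .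
  qed
  with assms show ?thesis
    unfolding grad_def by (rule the_equality)
qed

lemma
  assumes "smooth_on U H" "(q, p) \<in> U"
  shows grad_q_eq: "grad_q H q p = grad_block unit_q H (q, p)"
    and grad_p_eq: "grad_p H q p = grad_block unit_p H (q, p)"
proof -
  note D = has_derivative_phase[OF assms]
  have "((\<lambda>x. H (x, p)) has_derivative (\<lambda>v. v \<bullet> grad_block unit_q H (q, p))) (at q)"
    using has_derivative_compose[where f = "\<lambda>x. (x, p)" and f' = "\<lambda>v. (v, 0)" and s = UNIV, OF _ D]
    by (simp add: has_derivative_Pair grad_block_def inner_vec_def)
  then show "grad_q H q p = grad_block unit_q H (q, p)"
    unfolding grad_q_def by (intro grad_eqI) (simp add: gderiv_def)
  have "((\<lambda>y. H (q, y)) has_derivative (\<lambda>v. v \<bullet> grad_block unit_p H (q, p))) (at p)"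
    using has_derivative_compose[where f = "\<lambda>y. (q, y)" and f' = "\<lambda>v. (0, v)" and s = UNIV, OF _ D]
    by (simp add: has_derivative_Pair grad_block_def inner_vec_def)
  then show "grad_p H q p = grad_block unit_p H (q, p)"
    unfolding grad_p_def by (intro grad_eqI) (simp add: gderiv_def)
qed

lemma has_derivative_grad_block:
  assumes H: "smooth_on U H" and z: "z \<in> U" and u: "\<And>r. u r \<in> Basis"
  shows "(grad_block u H has_derivative
    (\<lambda>v. hess_block u unit_q H z *v fst v + hess_block u unit_p H z *v snd v)) (at z)"
proof -
  have "((\<lambda>x. grad_block u H x \<bullet> axis r 1) has_derivative
    (\<lambda>v. (hess_block u unit_q H z *v fst v + hess_block u unit_p H z *v snd v) \<bullet> axis r 1)) (at z)"
    for r
    using has_derivative_phase[OF smooth_on_partial[OF H u] z, of r]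
    by (simp add: grad_block_def hess_block_def inner_axis matrix_vector_mult_def mult.commute)
  then show ?thesis
    by (subst has_derivative_componentwise_within) (auto simp: Basis_vec_def)
qed

lemma
  assumes U: "open U" and H: "smooth_on U H" and z: "z \<in> U"
  shows has_derivative_grad_q: "((\<lambda>w. grad_q H (fst w) (snd w)) has_derivative
      (\<lambda>v. hess_block unit_q unit_q H z *v fst v + hess_block unit_q unit_p H z *v snd v)) (at z)"
    and has_derivative_grad_p: "((\<lambda>w. grad_p H (fst w) (snd w)) has_derivative
      (\<lambda>v. hess_block unit_p unit_q H z *v fst v + hess_block unit_p unit_p H z *v snd v)) (at z)"
  by (rule has_derivative_transform_within_open[OF has_derivative_grad_block[OF H z] U z];
      simp add: grad_q_eq[OF H] grad_p_eq[OF H])+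

lemma transpose_hess_block:
  assumes "open U" "smooth_on U H" "z \<in> U" "\<And>r. u r \<in> Basis" "\<And>r. w r \<in> Basis"
  shows "transpose (hess_block u w H z) = hess_block w u H z"
  using partial_commute[OF assms(1,3,2)] assms(4,5)
  by (simp add: vec_eq_iff transpose_def hess_block_def)

lemma grad_block_lipschitz:
  assumes "smooth_on U H" "compact D" "convex D" "D \<subseteq> U" "\<And>r. u r \<in> Basis"
  shows "\<exists>L. L-lipschitz_on D (grad_block u H)"
proof (rule lipschitz_on_componentwise)
  fix b :: "real^'a" assume "b \<in> Basis"
  then obtain r where "b = axis r 1"
    by (auto simp: Basis_vec_def)
  then have eq: "(\<lambda>z. grad_block u H z \<bullet> b) = partial (u r) H"
    by (simp add: grad_block_def inner_axis)
  show "\<exists>L. L-lipschitz_on D (\<lambda>z. grad_block u H z \<bullet> b)"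
    unfolding eq by (rule smooth_on_lipschitz[OF smooth_on_partial[OF assms(1,5)] assms(2-4)])
qed

lemma hess_block_lipschitz:
  assumes "smooth_on U H" "compact D" "convex D" "D \<subseteq> U" "\<And>r. u r \<in> Basis" "\<And>r. w r \<in> Basis"
  shows "\<exists>L. L-lipschitz_on D (hess_block u w H)"
proof (rule lipschitz_on_componentwise)
  fix b :: "real^'a^'a" assume "b \<in> Basis"
  then obtain r s where "b = axis r (axis s 1)"
    by (auto simp: Basis_vec_def)
  then have eq: "(\<lambda>z. hess_block u w H z \<bullet> b) = partial (w s) (partial (u r) H)"
    by (simp add: hess_block_def inner_axis)
  show "\<exists>L. L-lipschitz_on D (\<lambda>z. hess_block u w H z \<bullet> b)"
    unfolding eq
    by (rule smooth_on_lipschitz[OF smooth_on_partial[OF smooth_on_partial[OF assms(1,5)] assms(6)] assms(2-4)])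
qed

section \<open>The Jacobian of the scheme\<close>

text \<open>
  The recursions arise from formally differentiating the iteration in \<open>q\<close> and in \<open>p\<close>. They make sense
  at every index: the term with index \<open>M + 1\<close> enters the error estimate although the scheme
  stops at \<open>p\<^sub>M\<close>.
\<close>

primrec iter_jac_q :: "('n::finite phase \<Rightarrow> real) \<Rightarrow> real \<Rightarrow> real^'n \<Rightarrow> real^'n \<Rightarrow> nat \<Rightarrow> real^'n^'n" where
  "iter_jac_q H h q p 0 = 0"
| "iter_jac_q H h q p (Suc n) = - (h *\<^sub>R (hess_block unit_q unit_q H (q, p_iter H h q p n)
     + hess_block unit_q unit_p H (q, p_iter H h q p n) ** iter_jac_q H h q p n))"

primrec iter_jac_p :: "('n::finite phase \<Rightarrow> real) \<Rightarrow> real \<Rightarrow> real^'n \<Rightarrow> real^'n \<Rightarrow> nat \<Rightarrow> real^'n^'n" where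
  "iter_jac_p H h q p 0 = mat 1"
| "iter_jac_p H h q p (Suc n) =
     mat 1 - h *\<^sub>R (hess_block unit_q unit_p H (q, p_iter H h q p n) ** iter_jac_p H h q p n)"

lemma uminus_matrix_vector_mult: "(- A) *v x = - (A *v x)" for A :: "real^'n^'m"
  by (simp add: vec_eq_iff matrix_vector_mult_def sum_negf)

lemmas matrix_vector_algebra = matrix_vector_mult_add_rdistrib matrix_vector_mult_diff_rdistrib
  matrix_vector_right_distrib uminus_matrix_vector_mult matrix_vector_mul_assoc
  scaleR_matrix_vector_assoc[symmetric]

text \<open>
  Since \<open>U\<close> is open, \<open>H\<^sub>q\<close> is differentiable at each point where the scheme evaluates it for the
  initial value \<open>(q, p)\<close>, and the chain rule applies step by step.
\<close>

lemma has_derivative_p_iter: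
  assumes U: "open U" and H: "smooth_on U H"
    and "\<forall>k<n. (q, p_iter H h q p k) \<in> U"
  shows "((\<lambda>w. p_iter H h (fst w) (snd w) n) has_derivative
    (\<lambda>v. iter_jac_q H h q p n *v fst v + iter_jac_p H h q p n *v snd v)) (at (q, p))"
  using assms(3)
proof (induction n)
  case 0
  show ?case
    by (auto intro!: derivative_eq_intros)
next
  case (Suc n)
  let ?z = "(q, p_iter H h q p n)"
  let ?Q = "iter_jac_q H h q p n" and ?P = "iter_jac_p H h q p n"
  have IH: "((\<lambda>w. p_iter H h (fst w) (snd w) n) has_derivative (\<lambda>v. ?Q *v fst v + ?P *v snd v)) (at (q, p))"
    using Suc by simp
  have "((\<lambda>w. grad_q H (fst w) (p_iter H h (fst w) (snd w) n)) has_derivative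
    (\<lambda>v. hess_block unit_q unit_q H ?z *v fst v
       + hess_block unit_q unit_p H ?z *v (?Q *v fst v + ?P *v snd v))) (at (q, p))"
    using has_derivative_compose[where f = "\<lambda>w. (fst w, p_iter H h (fst w) (snd w) n)"
        and g = "\<lambda>z. grad_q H (fst z) (snd z)"
        and g' = "\<lambda>v. hess_block unit_q unit_q H ?z *v fst v + hess_block unit_q unit_p H ?z *v snd v",
        OF has_derivative_Pair[OF has_derivative_fst[OF has_derivative_ident] IH]]
      has_derivative_grad_q[OF U H, of ?z] Suc.prems by simp
  from has_derivative_diff[OF has_derivative_snd[OF has_derivative_ident]
      has_derivative_scaleR_right[OF this, of h]]
  show ?case
    by (auto elim!: has_derivative_eq_rhs simp: matrix_vector_algebra algebra_simps)
qed

lemma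
  assumes U: "open U" and H: "smooth_on U H"
    and D: "\<forall>k\<le>M. (q, p_iter H h q p k) \<in> U"
  shows has_derivative_flow_q: "((\<lambda>w. fst (euler_flow H M h w)) has_derivative
      (\<lambda>v. (mat 1 + h *\<^sub>R (hess_block unit_p unit_q H (q, p_iter H h q p M)
             + hess_block unit_p unit_p H (q, p_iter H h q p M) ** iter_jac_q H h q p M)) *v fst v
         + (h *\<^sub>R (hess_block unit_p unit_p H (q, p_iter H h q p M) ** iter_jac_p H h q p M)) *v snd v))
      (at (q, p))"
    and has_derivative_flow_p: "((\<lambda>w. snd (euler_flow H M h w)) has_derivative
      (\<lambda>v. iter_jac_q H h q p M *v fst v + iter_jac_p H h q p M *v snd v)) (at (q, p))"
proof -
  let ?z = "(q, p_iter H h q p M)"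
  let ?Q = "iter_jac_q H h q p M" and ?P = "iter_jac_p H h q p M"
  have P: "((\<lambda>w. p_iter H h (fst w) (snd w) M) has_derivative (\<lambda>v. ?Q *v fst v + ?P *v snd v)) (at (q, p))"
    using has_derivative_p_iter[OF U H] D by simp
  then show "((\<lambda>w. snd (euler_flow H M h w)) has_derivative (\<lambda>v. ?Q *v fst v + ?P *v snd v)) (at (q, p))"
    by (simp add: euler_flow_def case_prod_beta Let_def)
  have "((\<lambda>w. grad_p H (fst w) (p_iter H h (fst w) (snd w) M)) has_derivative
    (\<lambda>v. hess_block unit_p unit_q H ?z *v fst v
       + hess_block unit_p unit_p H ?z *v (?Q *v fst v + ?P *v snd v))) (at (q, p))"
    using has_derivative_compose[where f = "\<lambda>w. (fst w, p_iter H h (fst w) (snd w) M)"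
        and g = "\<lambda>z. grad_p H (fst z) (snd z)"
        and g' = "\<lambda>v. hess_block unit_p unit_q H ?z *v fst v + hess_block unit_p unit_p H ?z *v snd v",
        OF has_derivative_Pair[OF has_derivative_fst[OF has_derivative_ident] P]]
      has_derivative_grad_p[OF U H, of ?z] D by simp
  from has_derivative_add[OF has_derivative_fst[OF has_derivative_ident]
      has_derivative_scaleR_right[OF this, of h]]
  show "((\<lambda>w. fst (euler_flow H M h w)) has_derivative
      (\<lambda>v. (mat 1 + h *\<^sub>R (hess_block unit_p unit_q H ?z + hess_block unit_p unit_p H ?z ** ?Q)) *v fst v
         + (h *\<^sub>R (hess_block unit_p unit_p H ?z ** ?P)) *v snd v)) (at (q, p))"
    by (auto simp: euler_flow_def case_prod_beta Let_def elim!: has_derivative_eq_rhs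
        simp: matrix_vector_algebra algebra_simps)
qed

lemma
  assumes "(f has_derivative (\<lambda>v. X *v fst v + Y *v snd v)) (at z)"
  shows jac_q_eqI: "jac_q f z = X" and jac_p_eqI: "jac_p f z = Y"
proof -
  have "((\<lambda>x. f (x, snd z)) has_derivative (\<lambda>v. X *v v)) (at (fst z))"
    using has_derivative_compose[where f = "\<lambda>x. (x, snd z)" and g = f and x = "fst z" and s = UNIV
        and f' = "\<lambda>v. (v, 0)" and g' = "\<lambda>v. X *v fst v + Y *v snd v"] assms
    by (simp add: has_derivative_Pair)
  then show "jac_q f z = X"
    by (simp add: jac_q_def jacobian_def flip: frechet_derivative_at)
  have "((\<lambda>y. f (fst z, y)) has_derivative (\<lambda>v. Y *v v)) (at (snd z))"
    using has_derivative_compose[where f = "\<lambda>y. (fst z, y)" and g = f and x = "snd z" and s = UNIV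
        and f' = "\<lambda>v. (0, v)" and g' = "\<lambda>v. X *v fst v + Y *v snd v"] assms
    by (simp add: has_derivative_Pair)
  then show "jac_p f z = Y"
    by (simp add: jac_p_def jacobian_def flip: frechet_derivative_at)
qed

section \<open>The diagonal blocks\<close>

lemma
  fixes A B :: "real^'n^'m"
  shows transpose_add: "transpose (A + B) = transpose A + transpose B"
    and transpose_diff: "transpose (A - B) = transpose A - transpose B"
    and transpose_uminus: "transpose (- A) = - transpose A"
  by (simp_all add: vec_eq_iff transpose_def)

lemma matrix_add_rdistrib: "(A + B) ** C = A ** C + B ** C"
  by (simp add: vec_eq_iff matrix_matrix_mult_def distrib_right sum.distrib)

lemma bounded_bilinear_matrix_mult:
  "bounded_bilinear (\<lambda>(A :: real^'n^'m) (B :: real^'k^'n). A ** B)"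
  unfolding bilinear_conv_bounded_bilinear[symmetric] bilinear_def
  by (auto intro!: linearI simp: matrix_add_ldistrib matrix_add_rdistrib matrix_scalar_ac
      scalar_matrix_assoc)

lemmas matrix_mult_diff_right = bounded_bilinear.diff_right[OF bounded_bilinear_matrix_mult]
  and matrix_mult_diff_left = bounded_bilinear.diff_left[OF bounded_bilinear_matrix_mult]
  and matrix_mult_zero_right = bounded_bilinear.zero_right[OF bounded_bilinear_matrix_mult]

lemmas matrix_algebra = transpose_add transpose_diff transpose_uminus transpose_scalar
  matrix_transpose_mul matrix_add_ldistrib matrix_add_rdistrib matrix_mult_diff_right
  matrix_mult_diff_left matrix_mult_uminus matrix_scalar_ac scalar_matrix_assoc[symmetric]
  matrix_mul_assoc[symmetric]

lemma norm_transpose: "norm (transpose A) = norm (A :: real^'n^'m)"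
proof -
  have "(\<Sum>i\<in>UNIV. \<Sum>j\<in>UNIV. (A $ j $ i)\<^sup>2) = (\<Sum>j\<in>UNIV. \<Sum>i\<in>UNIV. (A $ j $ i)\<^sup>2)"
    by (rule sum.swap)
  then show ?thesis
    by (simp add: norm_vec_def L2_set_def transpose_def sum_nonneg)
qed

lemma mat_bracket_symmetric_mult:
  assumes "transpose E = E"
  shows "mat_bracket (h *\<^sub>R (E ** P)) P = 0"
  by (simp add: mat_bracket_def matrix_algebra assms)

text \<open>
  The matrix \<open>E\<close> drops out since \<open>Q\<^sup>T E Q\<close> is symmetric; the right-hand side contains \<open>A\<close> only
  through the symmetric matrix \<open>h A\<close>, which cancels in the difference with the transpose. It is
  inserted so that the difference can be read as the defect of \<open>Q\<close> in the iteration
  \<open>Q \<mapsto> - h (A + B Q)\<close>.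
\<close>

lemma mat_bracket_fixed_point_defect:
  fixes A B C E Q :: "real^'n^'n" and h :: real
  assumes "transpose A = A" "transpose E = E" "transpose B = C"
  shows "mat_bracket (mat 1 + h *\<^sub>R (C + E ** Q)) Q =
    transpose (- (h *\<^sub>R (A + B ** Q)) - Q) - (- (h *\<^sub>R (A + B ** Q)) - Q)"
  unfolding mat_bracket_def assms(3)[symmetric]
  by (simp add: matrix_algebra assms(1,2) algebra_simps)

section \<open>Convergence of the fixed point iterates and their Jacobians\<close>

text \<open>
  The iteration map has Lipschitz constant \<open>h L\<close>, so every step shrinks the increment by this factor.
\<close>

lemma p_iter_step_bound:
  assumes H: "smooth_on U H" and D: "D \<subseteq> U"
    and L: "L-lipschitz_on D (grad_block unit_q H)"
    and K: "\<And>z. z \<in> D \<Longrightarrow> norm (grad_block unit_q H z) \<le> K"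
    and h: "0 \<le> h" and adm: "\<forall>k\<le>n. (q, p_iter H h q p k) \<in> D"
  shows "norm (p_iter H h q p (Suc n) - p_iter H h q p n) \<le> K * L ^ n * h ^ Suc n"
  using adm
proof (induction n)
  case 0
  then have "(q, p) \<in> D"
    by simp
  then show ?case
    using grad_q_eq[OF H, of q p] D K[of "(q, p)"] h
    by (simp add: subset_iff mult.commute[of K] mult_left_mono)
next
  case (Suc n)
  let ?p = "p_iter H h q p" and ?G = "grad_block unit_q H"
  have inD: "(q, ?p n) \<in> D" "(q, ?p (Suc n)) \<in> D"
    using Suc.prems by auto
  have "?p (Suc (Suc n)) - ?p (Suc n) = h *\<^sub>R (?G (q, ?p n) - ?G (q, ?p (Suc n)))"
    using grad_q_eq[OF H subsetD[OF D inD(1)]] grad_q_eq[OF H subsetD[OF D inD(2)]]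
    by (simp add: scaleR_diff_right)
  also have "norm \<dots> = h * dist (?G (q, ?p (Suc n))) (?G (q, ?p n))"
    using h by (simp add: dist_norm norm_minus_commute)
  also have "\<dots> \<le> h * (L * norm (?p (Suc n) - ?p n))"
    using lipschitz_onD[OF L inD(2,1)] h
    by (intro mult_left_mono) (auto simp: dist_Pair_Pair dist_norm)
  also have "\<dots> \<le> h * (L * (K * L ^ n * h ^ Suc n))"
    using Suc h lipschitz_on_nonneg[OF L] by (intro mult_left_mono) auto
  finally show ?case
    by (simp add: mult_ac)
qed

text \<open>
  The norm of matrices is the Euclidean norm of their entries, and any constant in place of
  submultiplicativity suffices for asymptotic bounds.
\<close>

lemma norm_matrix_mult_le:
  "\<exists>\<kappa>>0. \<forall>(A :: real^'n^'m) (B :: real^'k^'n). norm (A ** B) \<le> norm A * norm B * \<kappa>"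
  by (rule bounded_bilinear.pos_bounded[OF bounded_bilinear_matrix_mult])

lemma iter_jac_q_bounded:
  fixes H :: "'n::finite phase \<Rightarrow> real"
  assumes "\<And>z. z \<in> D \<Longrightarrow> norm (hess_block unit_q unit_q H z) \<le> K"
    and "\<And>z. z \<in> D \<Longrightarrow> norm (hess_block unit_q unit_p H z) \<le> K"
  shows "\<exists>c. \<forall>h q p. 0 \<le> h \<and> h \<le> 1 \<and> (\<forall>k<n. (q, p_iter H h q p k) \<in> D) \<longrightarrow>
    norm (iter_jac_q H h q p n) \<le> c"
proof (induction n)
  case 0
  show ?case by (intro exI[of _ 0]) simp
next
  case (Suc n)
  then obtain c where c: "\<And>h q p. 0 \<le> h \<Longrightarrow> h \<le> 1 \<Longrightarrow> \<forall>k<n. (q, p_iter H h q p k) \<in> D \<Longrightarrow>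
    norm (iter_jac_q H h q p n) \<le> c"
    by blast
  obtain \<kappa> where \<kappa>: "\<kappa> > 0" "\<And>(A :: real^'n^'n) (B :: real^'n^'n). norm (A ** B) \<le> norm A * norm B * \<kappa>"
    using norm_matrix_mult_le by blast
  have "norm (iter_jac_q H h q p (Suc n)) \<le> K + K * c * \<kappa>"
    if h: "0 \<le> h" "h \<le> 1" and adm: "\<forall>k<Suc n. (q, p_iter H h q p k) \<in> D" for h q p
  proof -
    let ?z = "(q, p_iter H h q p n)" and ?Q = "iter_jac_q H h q p n"
    let ?A = "hess_block unit_q unit_q H" and ?B = "hess_block unit_q unit_p H"
    have z: "?z \<in> D"
      using adm by simp
    have "norm (iter_jac_q H h q p (Suc n)) = h * norm (?A ?z + ?B ?z ** ?Q)"
      using h by simp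
    also have "\<dots> \<le> norm (?A ?z + ?B ?z ** ?Q)"
      using h by (simp add: mult_left_le_one_le)
    also have "\<dots> \<le> norm (?A ?z) + norm (?B ?z) * norm ?Q * \<kappa>"
      using norm_triangle_le[OF add_left_mono[OF \<kappa>(2)]] by blast
    also have "\<dots> \<le> K + K * c * \<kappa>"
      using assms(1)[OF z] assms(2)[OF z] c[OF h] adm \<kappa>(1)
        order_trans[OF norm_ge_zero assms(2)[OF z]]
      by (intro add_mono mult_right_mono mult_mono) auto
    finally show ?thesis .
  qed
  then show ?case by blast
qed

text \<open>
  Subtracting two consecutive steps of the recursion gives
  \<open>Q\<^sub>n\<^sub>+\<^sub>2 - Q\<^sub>n\<^sub>+\<^sub>1 = - h ((A\<^sub>n\<^sub>+\<^sub>1 - A\<^sub>n) + B\<^sub>n\<^sub>+\<^sub>1 (Q\<^sub>n\<^sub>+\<^sub>1 - Q\<^sub>n) + (B\<^sub>n\<^sub>+\<^sub>1 - B\<^sub>n) Q\<^sub>n)\<close>.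
  The differences of \<open>A\<close> and \<open>B\<close> are of the order of \<open>p\<^sub>n\<^sub>+\<^sub>1 - p\<^sub>n\<close>, the middle term is controlled by
  induction, and the prefactor \<open>h\<close> supplies the additional power. The constants must not
  depend on \<open>h\<close> and \<open>(q, p)\<close>, which is why the induction is over the uniform statement.
\<close>

lemma iter_jac_q_step_bound:
  fixes H :: "'n::finite phase \<Rightarrow> real"
  assumes H: "smooth_on U H" and D: "compact D" "convex D" "D \<subseteq> U"
  shows "\<exists>c. \<forall>h q p. 0 \<le> h \<and> h \<le> 1 \<and> (\<forall>k\<le>n. (q, p_iter H h q p k) \<in> D) \<longrightarrow>
    norm (iter_jac_q H h q p (Suc n) - iter_jac_q H h q p n) \<le> c * h ^ Suc n"
proof -
  let ?A = "hess_block unit_q unit_q H" and ?B = "hess_block unit_q unit_p H"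
    and ?G = "grad_block unit_q H"
  obtain LA LB LG where LA: "LA-lipschitz_on D ?A" and LB: "LB-lipschitz_on D ?B"
    and LG: "LG-lipschitz_on D ?G"
    using hess_block_lipschitz[OF H D] grad_block_lipschitz[OF H D] unit_in_Basis by metis
  have bounded: "\<exists>K. \<forall>z\<in>D. norm (f z) \<le> K" if "L-lipschitz_on D f"
    for L and f :: "'n phase \<Rightarrow> 'b::real_normed_vector"
    using compact_imp_bounded[OF compact_continuous_image[OF lipschitz_on_continuous_on[OF that] D(1)]]
    by (auto simp: bounded_iff)
  obtain KA KB KG where KA: "\<And>z. z \<in> D \<Longrightarrow> norm (?A z) \<le> KA"
    and KB: "\<And>z. z \<in> D \<Longrightarrow> norm (?B z) \<le> KB" and KG: "\<And>z. z \<in> D \<Longrightarrow> norm (?G z) \<le> KG"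
    using bounded[OF LA] bounded[OF LB] bounded[OF LG] by blast
  obtain \<kappa> where \<kappa>: "\<kappa> > 0" "\<And>(A :: real^'n^'n) (B :: real^'n^'n). norm (A ** B) \<le> norm A * norm B * \<kappa>"
    using norm_matrix_mult_le by blast
  show ?thesis
  proof (induction n)
    case 0
    have "norm (iter_jac_q H h q p (Suc 0) - iter_jac_q H h q p 0) \<le> KA * h ^ Suc 0"
      if "0 \<le> h" "(q, p) \<in> D" for h q p
      using that KA[of "(q, p)"]
      by (simp add: matrix_mult_zero_right mult.commute[of KA] mult_left_mono)
    then show ?case by auto
  next
    case (Suc n)
    then obtain c where c: "\<And>h q p. 0 \<le> h \<Longrightarrow> h \<le> 1 \<Longrightarrow> \<forall>k\<le>n. (q, p_iter H h q p k) \<in> D \<Longrightarrow>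
      norm (iter_jac_q H h q p (Suc n) - iter_jac_q H h q p n) \<le> c * h ^ Suc n"
      by blast
    have "\<exists>R. \<forall>h q p. 0 \<le> h \<and> h \<le> 1 \<and> (\<forall>k<n. (q, p_iter H h q p k) \<in> D) \<longrightarrow>
      norm (iter_jac_q H h q p n) \<le> R"
      by (rule iter_jac_q_bounded[where K = "max KA KB"]) (use KA KB in \<open>auto simp: le_max_iff_disj\<close>)
    then obtain R where R: "\<And>h q p. 0 \<le> h \<Longrightarrow> h \<le> 1 \<Longrightarrow> \<forall>k<n. (q, p_iter H h q p k) \<in> D \<Longrightarrow>
      norm (iter_jac_q H h q p n) \<le> R"
      by blast
    define d where "d = KG * LG ^ n"
    have "norm (iter_jac_q H h q p (Suc (Suc n)) - iter_jac_q H h q p (Suc n))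
        \<le> (LA * d + KB * c * \<kappa> + LB * d * R * \<kappa>) * h ^ Suc (Suc n)"
      if h: "0 \<le> h" "h \<le> 1" and adm: "\<forall>k\<le>Suc n. (q, p_iter H h q p k) \<in> D" for h q p
    proof -
      let ?p = "p_iter H h q p" and ?Q = "iter_jac_q H h q p"
      let ?z = "(q, ?p n)" and ?z' = "(q, ?p (Suc n))"
      have z: "?z \<in> D" "?z' \<in> D"
        using adm by auto
      have "dist ?z' ?z \<le> d * h ^ Suc n"
        using p_iter_step_bound[OF H D(3) LG KG h(1), of n q p] adm
        by (simp add: dist_Pair_Pair dist_norm d_def)
      then have dz: "L * dist ?z' ?z \<le> L * d * h ^ Suc n" if "L \<ge> 0" for L
        using mult_left_mono[OF _ that] by (simp add: mult.assoc)
      have A: "norm (?A ?z' - ?A ?z) \<le> LA * d * h ^ Suc n"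
        using lipschitz_onD[OF LA z(2,1)] dz[OF lipschitz_on_nonneg[OF LA]] by (simp add: dist_norm)
      have B: "norm (?B ?z' - ?B ?z) \<le> LB * d * h ^ Suc n"
        using lipschitz_onD[OF LB z(2,1)] dz[OF lipschitz_on_nonneg[OF LB]] by (simp add: dist_norm)
      have BQ': "norm (?B ?z' ** (?Q (Suc n) - ?Q n)) \<le> KB * (c * h ^ Suc n) * \<kappa>"
        by (rule order_trans[OF \<kappa>(2)], intro mult_right_mono mult_mono)
          (use KB[OF z(2)] order_trans[OF norm_ge_zero KB[OF z(2)]] c[OF h, of q p] adm \<kappa>(1) in
            \<open>auto simp del: iter_jac_q.simps p_iter.simps\<close>)
      have BQ: "norm ((?B ?z' - ?B ?z) ** ?Q n) \<le> LB * d * h ^ Suc n * R * \<kappa>"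
        by (rule order_trans[OF \<kappa>(2)], intro mult_right_mono mult_mono)
          (use B order_trans[OF norm_ge_zero B] R[OF h, of q p] adm \<kappa>(1) in
            \<open>auto simp del: iter_jac_q.simps p_iter.simps\<close>)
      have "?Q (Suc (Suc n)) - ?Q (Suc n) =
        - (h *\<^sub>R ((?A ?z' + ?B ?z' ** ?Q (Suc n)) - (?A ?z + ?B ?z ** ?Q n)))"
        by (simp only: iter_jac_q.simps scaleR_diff_right) simp
      also have "(?A ?z' + ?B ?z' ** ?Q (Suc n)) - (?A ?z + ?B ?z ** ?Q n) =
        (?A ?z' - ?A ?z) + ?B ?z' ** (?Q (Suc n) - ?Q n) + (?B ?z' - ?B ?z) ** ?Q n"
        by (simp add: matrix_mult_diff_left matrix_mult_diff_right del: iter_jac_q.simps p_iter.simps)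
      finally have "norm (?Q (Suc (Suc n)) - ?Q (Suc n)) =
        h * norm ((?A ?z' - ?A ?z) + ?B ?z' ** (?Q (Suc n) - ?Q n) + (?B ?z' - ?B ?z) ** ?Q n)"
        using h(1) by (simp del: iter_jac_q.simps p_iter.simps)
      also have "\<dots> \<le> h * (LA * d * h ^ Suc n + KB * (c * h ^ Suc n) * \<kappa> + LB * d * h ^ Suc n * R * \<kappa>)"
        by (intro mult_left_mono norm_triangle_le[OF add_mono] A BQ BQ' h(1))
      finally show ?thesis
        by (simp add: algebra_simps del: iter_jac_q.simps p_iter.simps)
    qed
    then show ?case by blast
  qed
qed

section \<open>Near-symplecticity of the scheme\<close>

theorem theorem2:
  fixes H :: "'n::finite phase \<Rightarrow> real" and D :: "'n phase set" and M :: nat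
  assumes "compact D" and "convex D"
    and "\<exists>U. open U \<and> D \<subseteq> U \<and> smooth_on U H"
    and "M \<ge> 1"
  shows "\<exists>C. \<forall>S h0. admissible H D M S h0 \<longrightarrow>
    (\<forall>h z. 0 < h \<and> h \<le> h0 \<and> z \<in> S \<longrightarrow>
      (let F = euler_flow H M h;
           qt = (\<lambda>w. fst (F w));
           pt = (\<lambda>w. snd (F w))
       in F differentiable (at z) \<and>
          upper_left (J_tilde F z) = mat_bracket (jac_q qt z) (jac_q pt z) \<and>
          lower_right (J_tilde F z) = mat_bracket (jac_p qt z) (jac_p pt z) \<and>
          mat_bracket (jac_p qt z) (jac_p pt z) = 0)) \<and>
    (\<exists>\<delta>>0. \<forall>h z. 0 < h \<and> h \<le> h0 \<and> h \<le> \<delta> \<and> z \<in> S \<longrightarrow>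
      (let F = euler_flow H M h;
           qt = (\<lambda>w. fst (F w));
           pt = (\<lambda>w. snd (F w))
       in norm (mat_bracket (jac_q qt z) (jac_q pt z)) \<le> C * h ^ (M + 1)))"
proof -
  obtain U where U: "open U" and DU: "D \<subseteq> U" and H: "smooth_on U H"
    using assms(3) by blast
  obtain c where c: "\<And>h q p. 0 \<le> h \<Longrightarrow> h \<le> 1 \<Longrightarrow> \<forall>k\<le>M. (q, p_iter H h q p k) \<in> D \<Longrightarrow>
    norm (iter_jac_q H h q p (Suc M) - iter_jac_q H h q p M) \<le> c * h ^ Suc M"
    using iter_jac_q_step_bound[OF H assms(1,2) DU, of M] by blast
  have differentiable: "euler_flow H M h differentiable (at (q, p))"
    and bracket_p: "mat_bracket (jac_p (\<lambda>w. fst (euler_flow H M h w)) (q, p))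
      (jac_p (\<lambda>w. snd (euler_flow H M h w)) (q, p)) = 0"
    and bracket_q: "0 \<le> h \<Longrightarrow> h \<le> 1 \<Longrightarrow> norm (mat_bracket (jac_q (\<lambda>w. fst (euler_flow H M h w)) (q, p))
      (jac_q (\<lambda>w. snd (euler_flow H M h w)) (q, p))) \<le> 2 * c * h ^ (M + 1)"
    if adm: "\<forall>k\<le>M. (q, p_iter H h q p k) \<in> D" for h q p
  proof -
    let ?z = "(q, p_iter H h q p M)"
    have z: "?z \<in> U" and admU: "\<forall>k\<le>M. (q, p_iter H h q p k) \<in> U"
      using adm DU by auto
    note flow_q = has_derivative_flow_q[OF U H admU] and flow_p = has_derivative_flow_p[OF U H admU]
    note sym = transpose_hess_block[OF U H z, of unit_q unit_q]
      transpose_hess_block[OF U H z, of unit_q unit_p]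
      transpose_hess_block[OF U H z, of unit_p unit_p]
    show "euler_flow H M h differentiable (at (q, p))"
      using has_derivative_Pair[OF flow_q flow_p] by (auto simp: differentiable_def)
    show "mat_bracket (jac_p (\<lambda>w. fst (euler_flow H M h w)) (q, p))
      (jac_p (\<lambda>w. snd (euler_flow H M h w)) (q, p)) = 0"
      unfolding jac_p_eqI[OF flow_q] jac_p_eqI[OF flow_p]
      by (rule mat_bracket_symmetric_mult) (simp add: sym)
    assume h: "0 \<le> h" "h \<le> 1"
    \<comment> \<open>The block equals \<open>transpose \<Delta> - \<Delta>\<close>, and transposition preserves the norm: hence the factor 2.\<close>
    let ?\<Delta> = "iter_jac_q H h q p (Suc M) - iter_jac_q H h q p M"
    have "mat_bracket (jac_q (\<lambda>w. fst (euler_flow H M h w)) (q, p))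
      (jac_q (\<lambda>w. snd (euler_flow H M h w)) (q, p)) = transpose ?\<Delta> - ?\<Delta>"
      unfolding jac_q_eqI[OF flow_q] jac_q_eqI[OF flow_p] iter_jac_q.simps
      by (rule mat_bracket_fixed_point_defect) (simp_all add: sym)
    also have "norm \<dots> \<le> norm (transpose ?\<Delta>) + norm ?\<Delta>"
      by (rule norm_triangle_ineq4)
    also have "\<dots> \<le> 2 * (c * h ^ Suc M)"
      using c[OF h adm] by (simp only: norm_transpose)
    finally show "norm (mat_bracket (jac_q (\<lambda>w. fst (euler_flow H M h w)) (q, p))
      (jac_q (\<lambda>w. snd (euler_flow H M h w)) (q, p))) \<le> 2 * c * h ^ (M + 1)"
      by simp
  qed
  have adm: "\<forall>k\<le>M. (q, p_iter H h q p k) \<in> D"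
    if "admissible H D M S h0" "0 < h" "h \<le> h0" "(q, p) \<in> S" for S h0 h q p
    using that unfolding admissible_def by blast
  show ?thesis
  proof (rule exI[of _ "2 * c"], intro allI impI conjI)
    fix S h0 h and z :: "'n phase"
    assume S: "admissible H D M S h0" and hz: "0 < h \<and> h \<le> h0 \<and> z \<in> S"
    obtain q p where z: "z = (q, p)" by (cases z)
    show "let F = euler_flow H M h; qt = (\<lambda>w. fst (F w)); pt = (\<lambda>w. snd (F w))
      in F differentiable (at z) \<and>
          upper_left (J_tilde F z) = mat_bracket (jac_q qt z) (jac_q pt z) \<and>
          lower_right (J_tilde F z) = mat_bracket (jac_p qt z) (jac_p pt z) \<and>
          mat_bracket (jac_p qt z) (jac_p pt z) = 0"
      using differentiable bracket_p adm[OF S, of h q p] hz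
      by (simp add: Let_def upper_left_J_tilde lower_right_J_tilde z)
  next
    fix S h0
    assume S: "admissible H D M S h0"
    show "\<exists>\<delta>>0. \<forall>h z. 0 < h \<and> h \<le> h0 \<and> h \<le> \<delta> \<and> z \<in> S \<longrightarrow>
      (let F = euler_flow H M h; qt = (\<lambda>w. fst (F w)); pt = (\<lambda>w. snd (F w))
       in norm (mat_bracket (jac_q qt z) (jac_q pt z)) \<le> 2 * c * h ^ (M + 1))"
      using bracket_q adm[OF S]
      by (intro exI[of _ 1]) (auto simp: Let_def)
  qed
qed

end
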